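(* Let $G=(V,E,\gamma)$, $V=[n]$, be a connected undirected weighted graph, $\hat\delta\in\mathbb{R}^n$, and suppose $$\mathcal{U}_{\mathcal S}=\{\delta\in\mathbb{R}^n : |\delta_i-\hat\delta_i|\le\gamma_{ii}\ \forall i\in[n],\ |\delta_i-\delta_j|\le\gamma_{ij}\ \forall\{i,j\}\in E\}$$ is nonempty. Let $\mathcal{Z}\subseteq\mathbb{R}^{n_x}_+\times\mathbb{R}^{n_y}_+$, $C\in\mathbb{R}^{n\times n_x}$ with rows $C_1,\dots,C_n$, and let $(x,y)\in\mathcal{Z}$. Let $\underline\delta,\bar\delta\in\mathbb{R}^n$ be defined by $$\underline\delta_j=\max_{k\in V}\{\hat\delta_k-\gamma_{kk}-\mathrm{dist}(k,j)\},\qquad \bar\delta_j=\min_{k\in V}\{\hat\delta_k+\gamma_{kk}+\mathrm{dist}(k,j)\},\qquad j\in[n].$$ Consider the problem $\max_{\delta\in\mathcal{U}_{\mathcal S}}\delta^\top Cx$. (i) If there exists $j\in[n]$ such that $S^{++}=\{j\}$ and $S^-=[n]\setminus\{j\}$, then there exists an optimal solution $\delta'$ of this problem satisfying either (a) $\delta'_j=\bar\delta_j$ and $\delta'_k=\max\{\underline\delta_k,\bar\delta_j-\mathrm{dist}(k,j)\}$ for all $k\ne j$, or (b) for some $l\ne j$ with $\underline\delta_l<\bar\delta_j-\mathrm{dist}(l,j)$: $\delta'_l=\underline\delta_l$, $\delta'_j=\underline\delta_l+\mathrm{dist}(l,j)$, and $\delta'_k=\max\{\underline\delta_k,\delta'_j-\mathrm{dist}(k,j)\}$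 for all $k\notin\{j,l\}$. (ii) If there exists $j\in[n]$ such that $S^{--}=\{j\}$ and $S^+=[n]\setminus\{j\}$, then there exists an optimal solution $\delta'$ of this problem satisfying either (a) $\delta'_j=\underline\delta_j$ and $\delta'_k=\min\{\bar\delta_k,\underline\delta_j+\mathrm{dist}(k,j)\}$ for all $k\ne j$, or (b) for some $l\ne j$ with $\bar\delta_l>\underline\delta_j+\mathrm{dist}(l,j)$: $\delta'_l=\bar\delta_l$, $\delta'_j=\bar\delta_l-\mathrm{dist}(l,j)$, and $\delta'_k=\min\{\bar\delta_k,\delta'_j+\mathrm{dist}(k,j)\}$ for all $k\notin\{j,l\}$.
   Context: $[n]=\{1,\dots,n\}$. Weights $\gamma_{ij}=\gamma_{ji}\ge 0$ are given for $\{i,j\}\in E$ (edges join distinct vertices), together with $\gamma_{ii}\ge 0$ for $i\in[n]$. For $i\ne j$, $\mathrm{dist}(i,j)$ is the length of a shortest path between $i$ and $j$ in $G$ with respect to the edge weights $\gamma$, and $\mathrm{dist}(j,j)=0$. The sign sets are $S^+=\{j\in[n]: C_jx\ge 0\ \forall (x,y)\in\mathcal{Z}\}$, $S^-=\{j\in[n]: C_jx\le 0\ \forall (x,y)\in\mathcal{Z}\}$, $S^{++}=S^+\setminus S^-$ (equivalently, those $j\in S^+$ with $C_jx>0$ for some $(x,y)\in\mathcal{Z}$), and $S^{--}=S^-\setminus S^+$. *)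

theory Defs
  imports
    "HOL-Analysis.Analysis"
    "Graph_Theory.Digraph_Component"
    "Graph_Theory.Shortest_Path"
begin

text \<open>
  A finite simple undirected graph is a \<open>pair_graph\<close>: finite, loop-free and symmetric, so that an
  edge \<open>{i, j}\<close> is represented by the two arcs \<open>(i, j)\<close> and \<open>(j, i)\<close>. Vectors indexed by the vertex
  set \<open>{1..n}\<close> have type \<open>real ^ 'n\<close>, with \<open>n = CARD('n)\<close> and \<open>'n\<close> itself as the vertex set.
  The function \<open>\<gamma>\<close> holds the edge weights off the diagonal and the node parameters on it.
\<close>

definition weighted_graph :: "'n pair_pre_digraph \<Rightarrow> ('n \<Rightarrow> 'n \<Rightarrow> real) \<Rightarrow> bool" where
  "weighted_graph G \<gamma> \<longleftrightarrow>
     pair_graph G \<and> pverts G = UNIV \<and>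
     (\<forall>(i, j) \<in> parcs G. \<gamma> i j = \<gamma> j i \<and> 0 \<le> \<gamma> i j) \<and>
     (\<forall>i. 0 \<le> \<gamma> i i)"

text \<open>
  The library's \<open>\<mu>\<close> is the infimum, in the extended reals, of the costs of all walks. In a connected
  graph with nonnegative weights it is finite and attained by a path; see
  \<open>graph_dist_shortest_path\<close> below.
\<close>

definition graph_dist :: "'n pair_pre_digraph \<Rightarrow> ('n \<Rightarrow> 'n \<Rightarrow> real) \<Rightarrow> 'n \<Rightarrow> 'n \<Rightarrow> real" where
  "graph_dist G \<gamma> i j = real_of_ereal (wf_digraph.\<mu> (with_proj G) (\<lambda>(u, v). \<gamma> u v) i j)"

lemma graph_dist_shortest_path:
  assumes wg: "weighted_graph G \<gamma>" and con: "Digraph_Component.connected (with_proj G)"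
  shows "\<exists>p. pre_digraph.apath (with_proj G) i p j \<and>
           graph_dist G \<gamma> i j = (\<Sum>(u, v)\<leftarrow>p. \<gamma> u v)"
    and "pre_digraph.awalk (with_proj G) i p j \<Longrightarrow> graph_dist G \<gamma> i j \<le> (\<Sum>(u, v)\<leftarrow>p. \<gamma> u v)"
    and "graph_dist G \<gamma> j j = 0"
proof -
  interpret G: pair_graph G using wg by (simp add: weighted_graph_def)
  let ?c = "\<lambda>(u, v). \<gamma> u v"
  have nn: "e \<in> parcs G \<Longrightarrow> 0 \<le> ?c e" for e
    using wg by (auto simp: weighted_graph_def)
  have V: "pverts G = UNIV" using wg by (simp add: weighted_graph_def)
  have ex: "\<exists>p. G.apath i p j \<and> G.\<mu> ?c i j = ereal (G.awalk_cost ?c p)" for i j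
  proof (rule G.min_cost_awalk)
    have "reachable (with_proj (mk_symmetric (with_proj G))) i j"
      using con V by (auto simp: connected_def strongly_connected_def)
    then show "reachable (with_proj G) i j"
      by (simp only: G.reachable_mk_symmetric_eq[OF G.sym_arcs])
  qed (use nn in auto)
  have ge: "graph_dist G \<gamma> i j \<le> G.awalk_cost ?c p" if "G.awalk i p j" for i j p
    using ex[of i j] G.min_cost_le_walk_cost[OF that, of ?c] by (auto simp: graph_dist_def)
  show "\<exists>p. G.apath i p j \<and> graph_dist G \<gamma> i j = (\<Sum>(u, v)\<leftarrow>p. \<gamma> u v)"
    using ex[of i j] by (auto simp: graph_dist_def G.awalk_cost_def)
  show "graph_dist G \<gamma> i j \<le> (\<Sum>(u, v)\<leftarrow>p. \<gamma> u v)" if "G.awalk i p j"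
    using ge[OF that] by (simp add: G.awalk_cost_def)
  obtain p where p: "G.apath j p j" "graph_dist G \<gamma> j j = G.awalk_cost ?c p"
    using ex[of j j] by (auto simp: graph_dist_def)
  have "0 \<le> G.awalk_cost ?c p"
    using p(1) nn by (intro G.pos_cost_pos_awalk_cost) (auto simp: G.apath_def)
  moreover have "graph_dist G \<gamma> j j \<le> G.awalk_cost ?c []"
    by (rule ge) (simp add: G.awalk_Nil_iff V)
  ultimately show "graph_dist G \<gamma> j j = 0" using p(2) by simp
qed

definition uncertainty_set ::
    "'n::finite pair_pre_digraph \<Rightarrow> ('n \<Rightarrow> 'n \<Rightarrow> real) \<Rightarrow> real ^ 'n \<Rightarrow> (real ^ 'n) set" where
  "uncertainty_set G \<gamma> \<delta>h =
     {\<delta>. (\<forall>i. \<bar>\<delta> $ i - \<delta>h $ i\<bar> \<le> \<gamma> i i) \<and> (\<forall>(i, j) \<in> parcs G. \<bar>\<delta> $ i - \<delta> $ j\<bar> \<le> \<gamma> i j)}"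

definition S_plus :: "real ^ 'm ^ 'n \<Rightarrow> ((real ^ 'm) \<times> (real ^ 'p)) set \<Rightarrow> 'n set" where
  "S_plus C Z = {j. \<forall>(x, y) \<in> Z. 0 \<le> (C $ j) \<bullet> x}"

definition S_minus :: "real ^ 'm ^ 'n \<Rightarrow> ((real ^ 'm) \<times> (real ^ 'p)) set \<Rightarrow> 'n set" where
  "S_minus C Z = {j. \<forall>(x, y) \<in> Z. (C $ j) \<bullet> x \<le> 0}"

definition S_plus_plus :: "real ^ 'm ^ 'n \<Rightarrow> ((real ^ 'm) \<times> (real ^ 'p)) set \<Rightarrow> 'n set" where
  "S_plus_plus C Z = S_plus C Z - S_minus C Z"

definition S_minus_minus :: "real ^ 'm ^ 'n \<Rightarrow> ((real ^ 'm) \<times> (real ^ 'p)) set \<Rightarrow> 'n set" where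
  "S_minus_minus C Z = S_minus C Z - S_plus C Z"

definition optimal_solution ::
    "(real ^ 'n) set \<Rightarrow> real ^ 'm ^ 'n \<Rightarrow> real ^ 'm \<Rightarrow> real ^ 'n \<Rightarrow> bool" where
  "optimal_solution U C x \<delta> \<longleftrightarrow> is_arg_max (\<lambda>\<delta>. \<delta> \<bullet> (C *v x)) (\<lambda>\<delta>. \<delta> \<in> U) \<delta>"

end

theory Submission
  imports Defs
begin

text \<open>
  Write \<open>d\<close> for the graph distance and \<open>w = C x\<close>. Feasible vectors are 1-Lipschitz for the
  pseudometric \<open>d\<close>, and \<open>lo\<close>, \<open>up\<close> are the best bounds that the node constraints imply through
  this condition. So the uncertainty set consists exactly of the vectors between \<open>lo\<close> and \<open>up\<close> that are
  1-Lipschitz for \<open>d\<close>, and it contains \<open>lo\<close> and \<open>up\<close> themselves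
  (\<open>uncertainty_set_eq_lipschitz_between\<close>).

  In case (i) the coordinate \<open>w\<^sub>j\<close> is nonnegative and all others are nonpositive. Once the value
  \<open>\<delta>\<^sub>j = t\<close> is chosen, the other coordinates should be as small as possible. Every feasible \<open>\<delta>\<close>
  satisfies \<open>\<delta>\<^sub>k \<ge> lo\<^sub>k\<close> and \<open>\<delta>\<^sub>k \<ge> t - d(k, j)\<close>, and the pointwise maximum of these two bounds is
  again feasible. The problem thus reduces to maximising over \<open>t\<close> the function
  \<open>w\<^sub>j t + (\<Sum>k \<noteq> j. w\<^sub>k max (lo\<^sub>k) (t - d(k, j)))\<close>, which is piecewise linear with breakpoints
  \<open>lo\<^sub>k + d(k, j)\<close>. From any \<open>t\<close> between two breakpoints one can move, without loss, either up or
  down to the next one; left of all breakpoints the slope is \<open>w\<^sub>j \<ge> 0\<close>, so one moves up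
  (\<open>hinge_sum_max_at_breakpoint\<close>). Hence \<open>t\<close> may be taken to be \<open>up\<^sub>j\<close>, which is alternative (a), or
  a breakpoint \<open>lo\<^sub>l + d(l, j)\<close> below \<open>up\<^sub>j\<close>, which is alternative (b).

  Case (ii) is case (i) for the reflected data \<open>-\<delta>\<close>, \<open>-up\<close>, \<open>-lo\<close>, \<open>-w\<close>.
\<close>

section \<open>Piecewise linear functions of one variable\<close>

text \<open>
  Between consecutive candidates the function is affine, whatever the signs of \<open>g\<close>, so it does not
  decrease in one of the two directions. The right end \<open>u\<close> stops the move to the right; the move to
  the left needs no end point, because left of all breakpoints the slope is \<open>c \<ge> 0\<close>.
\<close>

lemma hinge_sum_max_at_breakpoint:
  fixes b g :: "'k \<Rightarrow> real" and c t u :: real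
  assumes "finite I" and "0 \<le> c" and "t \<le> u"
  shows "\<exists>s \<in> insert u (b ` {k \<in> I. b k < u}).
           c * t + (\<Sum>k\<in>I. g k * max 0 (t - b k)) \<le> c * s + (\<Sum>k\<in>I. g k * max 0 (s - b k))"
proof -
  define F where "F s = c * s + (\<Sum>k\<in>I. g k * max 0 (s - b k))" for s
  define T where "T = insert u (b ` {k \<in> I. b k < u})"
  define K where "K = {k \<in> I. b k < t}"
  define A where "A = c + sum g K"
  have fin: "finite T" "finite K"
    using assms(1) by (auto simp: T_def K_def)
  have affine: "F s = F t + A * (s - t)"
    if sep: "\<And>k. k \<in> I \<Longrightarrow> if b k < t then b k \<le> s else s \<le> b k" for s
  proof -
    have "(\<Sum>k\<in>I. g k * max 0 (s - b k))
        = (\<Sum>k\<in>I. g k * max 0 (t - b k) + (if b k < t then g k * (s - t) else 0))"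
    proof (rule sum.cong)
      fix k assume "k \<in> I"
      from sep[OF this]
      show "g k * max 0 (s - b k) = g k * max 0 (t - b k) + (if b k < t then g k * (s - t) else 0)"
        by (auto simp: max_def algebra_simps split: if_splits)
    qed simp
    also have "\<dots> = (\<Sum>k\<in>I. g k * max 0 (t - b k)) + sum g K * (s - t)"
      using assms(1) by (simp add: sum.distrib K_def sum.If_cases sum_distrib_right Int_def)
    finally show ?thesis
      by (simp add: F_def A_def algebra_simps)
  qed
  have "\<exists>s\<in>T. F t \<le> F s"
  proof (cases "t \<in> T")
    case False
    then have tu: "t < u"
      using assms(3) by (auto simp: T_def)
    show ?thesis
    proof (cases "0 \<le> A")
      case True
      define s where "s = Min {s \<in> T. t < s}"
      have ne: "{s \<in> T. t < s} \<noteq> {}"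
        using tu by (auto simp: T_def)
      have s: "s \<in> T" "t < s"
        using Min_in[of "{s \<in> T. t < s}"] fin ne by (auto simp: s_def)
      have least: "s \<le> r" if "r \<in> T" "t < r" for r
        using that fin by (auto simp: s_def intro: Min_le)
      have "F s = F t + A * (s - t)"
      proof (rule affine)
        fix k assume k: "k \<in> I"
        have "s \<le> b k" if "\<not> b k < t"
        proof (cases "b k < u")
          case True
          then have "b k \<in> T"
            using k by (auto simp: T_def)
          then show ?thesis
            using least \<open>t \<notin> T\<close> that by (metis linorder_neqE_linordered_idom)
        next
          case False
          then show ?thesis
            using least[of u] tu by (auto simp: T_def)
        qed
        then show "if b k < t then b k \<le> s else s \<le> b k"
          using s(2) by auto
      qed
      moreover have "0 \<le> A * (s - t)"
        using True s(2) by simp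
      ultimately show ?thesis
        using s(1) by (intro bexI[of _ s]) linarith+
    next
      case False
      \<comment> \<open>A negative slope needs a breakpoint to the left, as \<open>c \<ge> 0\<close>.\<close>
      then have ne: "K \<noteq> {}"
        using assms(2) by (auto simp: A_def)
      define s where "s = Max (b ` K)"
      have "s \<in> b ` K"
        using fin ne by (simp add: s_def)
      then have s: "s \<in> T" "s < t"
        using tu by (auto simp: K_def T_def)
      have "F s = F t + A * (s - t)"
      proof (rule affine)
        fix k assume "k \<in> I"
        then have "b k \<le> s" if "b k < t"
          using that fin by (auto simp: s_def K_def intro!: Max_ge)
        then show "if b k < t then b k \<le> s else s \<le> b k"
          using s(2) by auto
      qed
      moreover have "0 \<le> A * (s - t)"
        using False s(2) by (simp add: mult_nonpos_nonpos)
      ultimately show ?thesis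
        using s(1) by (intro bexI[of _ s]) linarith+
    qed
  qed auto
  then show ?thesis
    by (simp only: F_def T_def)
qed

section \<open>Linear optimisation over Lipschitz vectors between two bounds\<close>

definition lipschitz_between ::
    "('n \<Rightarrow> 'n \<Rightarrow> real) \<Rightarrow> real ^ 'n \<Rightarrow> real ^ 'n \<Rightarrow> (real ^ 'n) set" where
  "lipschitz_between d lo up =
     {\<delta>. (\<forall>k. lo $ k \<le> \<delta> $ k \<and> \<delta> $ k \<le> up $ k) \<and> (\<forall>i k. \<bar>\<delta> $ i - \<delta> $ k\<bar> \<le> d i k)}"

text \<open>
  For fixed \<open>t = \<delta>\<^sub>j\<close> in the interval from \<open>lo\<^sub>j\<close> to \<open>up\<^sub>j\<close> the least feasible vector is \<open>p t\<close> below; it is Lipschitz as a maximum of two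
  Lipschitz functions and stays under \<open>up\<close> because \<open>t - d(k, j) \<le> up\<^sub>j - d(k, j) \<le> up\<^sub>k\<close>. The signs of
  \<open>w\<close> make it optimal among the feasible vectors with this \<open>j\<close>-th coordinate, and its value is a
  hinge sum in \<open>t\<close>.
\<close>

lemma lipschitz_between_optimum_one_positive:
  fixes d :: "'n::finite \<Rightarrow> 'n \<Rightarrow> real" and lo up w :: "real ^ 'n"
  assumes d0: "\<And>i. d i i = 0" and sym: "\<And>i k. d i k = d k i"
    and tri: "\<And>i k m. d i m \<le> d i k + d k m"
    and lo: "lo \<in> lipschitz_between d lo up" and up: "up \<in> lipschitz_between d lo up"
    and wj: "0 \<le> w $ j" and wk: "\<forall>k. k \<noteq> j \<longrightarrow> w $ k \<le> 0"
  shows "\<exists>\<delta> \<in> lipschitz_between d lo up. (\<forall>\<epsilon> \<in> lipschitz_between d lo up. \<epsilon> \<bullet> w \<le> \<delta> \<bullet> w) \<and>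
           (\<delta> $ j = up $ j \<and> (\<forall>k. k \<noteq> j \<longrightarrow> \<delta> $ k = max (lo $ k) (up $ j - d k j)) \<or>
            (\<exists>l. l \<noteq> j \<and> lo $ l < up $ j - d l j \<and>
               \<delta> $ l = lo $ l \<and> \<delta> $ j = lo $ l + d l j \<and>
               (\<forall>k. k \<notin> {j, l} \<longrightarrow> \<delta> $ k = max (lo $ k) (\<delta> $ j - d k j))))"
proof -
  let ?U = "lipschitz_between d lo up"
  define p :: "real \<Rightarrow> real ^ 'n" where "p t = (\<chi> k. max (lo $ k) (t - d k j))" for t
  define b where "b k = lo $ k + d k j" for k
  define S where "S = insert (up $ j) (b ` {k \<in> UNIV - {j}. b k < up $ j})"
  have lo_le_up: "lo $ k \<le> up $ k" for k
    using lo by (auto simp: lipschitz_between_def)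
  have lo_lip: "\<bar>lo $ i - lo $ k\<bar> \<le> d i k" and up_lip: "\<bar>up $ i - up $ k\<bar> \<le> d i k" for i k
    using lo up by (auto simp: lipschitz_between_def)
  have pj: "p t $ j = t" if "lo $ j \<le> t" for t
    using that by (simp add: p_def d0)
  have feasible: "p t \<in> ?U" if "t \<le> up $ j" for t
  proof -
    have "p t $ k \<le> up $ k" for k
      using that lo_le_up[of k] up_lip[of k j] by (simp add: p_def)
    moreover have "\<bar>p t $ i - p t $ k\<bar> \<le> d i k" for i k
      using lo_lip[of i k] tri[of i j k] tri[of k j i] sym[of i k]
      by (simp add: p_def max_def) linarith
    ultimately show ?thesis
      by (auto simp: lipschitz_between_def p_def)
  qed
  have dominates: "\<delta> \<bullet> w \<le> p (\<delta> $ j) \<bullet> w" if \<delta>: "\<delta> \<in> ?U" for \<delta>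
  proof -
    have bnd: "lo $ k \<le> \<delta> $ k" "\<bar>\<delta> $ k - \<delta> $ j\<bar> \<le> d k j" for k
      using \<delta> by (auto simp: lipschitz_between_def)
    have "\<delta> $ k * w $ k \<le> p (\<delta> $ j) $ k * w $ k" for k
    proof (cases "k = j")
      case False
      have "p (\<delta> $ j) $ k \<le> \<delta> $ k"
        using bnd[of k] by (simp add: p_def)
      then show ?thesis
        using wk False by (intro mult_right_mono_neg) auto
    qed (simp add: pj bnd)
    then show ?thesis
      by (simp add: inner_vec_def sum_mono)
  qed
  have objective: "p t \<bullet> w = (\<Sum>k\<in>UNIV - {j}. w $ k * lo $ k)
      + (w $ j * t + (\<Sum>k\<in>UNIV - {j}. w $ k * max 0 (t - b k)))" if "lo $ j \<le> t" for t
  proof -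
    have "p t \<bullet> w = w $ j * t + (\<Sum>k\<in>UNIV - {j}. w $ k * p t $ k)"
      using pj[OF that] by (simp add: inner_vec_def sum.remove[of _ j] mult.commute)
    also have "(\<Sum>k\<in>UNIV - {j}. w $ k * p t $ k)
        = (\<Sum>k\<in>UNIV - {j}. w $ k * lo $ k + w $ k * max 0 (t - b k))"
      by (rule sum.cong) (auto simp: p_def b_def max_def algebra_simps)
    finally show ?thesis
      by (simp add: sum.distrib)
  qed
  have S_bounds: "lo $ j \<le> s" "s \<le> up $ j" if "s \<in> S" for s
  proof -
    have "lo $ j \<le> b k" for k
      using lo_lip[of k j] by (simp add: b_def)
    then show "lo $ j \<le> s" "s \<le> up $ j"
      using that lo_le_up[of j] by (auto simp: S_def)
  qed
  have "finite S" "S \<noteq> {}"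
    by (auto simp: S_def)
  then have "Max ((\<lambda>r. p r \<bullet> w) ` S) \<in> (\<lambda>r. p r \<bullet> w) ` S"
    by simp
  then obtain s where s: "s \<in> S" and "p s \<bullet> w = Max ((\<lambda>r. p r \<bullet> w) ` S)"
    by auto
  with \<open>finite S\<close> have s_max: "p r \<bullet> w \<le> p s \<bullet> w" if "r \<in> S" for r
    using that by simp
  have optimal: "\<delta> \<bullet> w \<le> p s \<bullet> w" if \<delta>: "\<delta> \<in> ?U" for \<delta>
  proof -
    have bnd: "lo $ j \<le> \<delta> $ j" "\<delta> $ j \<le> up $ j"
      using \<delta> by (auto simp: lipschitz_between_def)
    have "\<exists>r\<in>S. w $ j * \<delta> $ j + (\<Sum>k\<in>UNIV - {j}. w $ k * max 0 (\<delta> $ j - b k))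
        \<le> w $ j * r + (\<Sum>k\<in>UNIV - {j}. w $ k * max 0 (r - b k))"
      unfolding S_def by (rule hinge_sum_max_at_breakpoint) (simp_all add: wj bnd)
    then obtain r where r: "r \<in> S"
      and le: "w $ j * \<delta> $ j + (\<Sum>k\<in>UNIV - {j}. w $ k * max 0 (\<delta> $ j - b k))
        \<le> w $ j * r + (\<Sum>k\<in>UNIV - {j}. w $ k * max 0 (r - b k))"
      by (elim bexE)
    have "p (\<delta> $ j) \<bullet> w \<le> p r \<bullet> w"
      using le unfolding objective[OF bnd(1)] objective[OF S_bounds(1)[OF r]] by linarith
    then show ?thesis
      using dominates[OF \<delta>] s_max[OF r] by linarith
  qed
  from s consider "s = up $ j" | l where "l \<noteq> j" "s = b l" "b l < up $ j"
    by (auto simp: S_def)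
  then show ?thesis
  proof cases
    case 1
    then show ?thesis
      using feasible[of s] optimal pj[OF S_bounds(1)[OF s]]
      by (intro bexI[of _ "p s"]) (auto simp: p_def)
  next
    case 2
    have "p s $ l = lo $ l"
      using 2 by (simp add: p_def b_def)
    then show ?thesis
      using 2 feasible[of s] optimal pj[OF S_bounds(1)[OF s]]
      by (intro bexI[of _ "p s"] conjI ballI disjI2 exI[of _ l]) (auto simp: p_def b_def)
  qed
qed

lemma minus_mem_lipschitz_between_iff:
  "- \<delta> \<in> lipschitz_between d (- up) (- lo) \<longleftrightarrow> \<delta> \<in> lipschitz_between d lo up"
  by (auto simp: lipschitz_between_def abs_minus_commute)

text \<open>The reflection \<open>\<delta> \<mapsto> -\<delta>\<close> exchanges the two bounds and the signs of \<open>w\<close>.\<close>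

lemma lipschitz_between_optimum_one_negative:
  fixes d :: "'n::finite \<Rightarrow> 'n \<Rightarrow> real" and lo up w :: "real ^ 'n"
  assumes d: "\<And>i. d i i = 0" "\<And>i k. d i k = d k i" "\<And>i k m. d i m \<le> d i k + d k m"
    and lo: "lo \<in> lipschitz_between d lo up" and up: "up \<in> lipschitz_between d lo up"
    and w: "w $ j \<le> 0" "\<forall>k. k \<noteq> j \<longrightarrow> 0 \<le> w $ k"
  shows "\<exists>\<delta> \<in> lipschitz_between d lo up. (\<forall>\<epsilon> \<in> lipschitz_between d lo up. \<epsilon> \<bullet> w \<le> \<delta> \<bullet> w) \<and>
           (\<delta> $ j = lo $ j \<and> (\<forall>k. k \<noteq> j \<longrightarrow> \<delta> $ k = min (up $ k) (lo $ j + d k j)) \<or>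
            (\<exists>l. l \<noteq> j \<and> up $ l > lo $ j + d l j \<and>
               \<delta> $ l = up $ l \<and> \<delta> $ j = up $ l - d l j \<and>
               (\<forall>k. k \<notin> {j, l} \<longrightarrow> \<delta> $ k = min (up $ k) (\<delta> $ j + d k j))))"
proof -
  have "\<exists>\<delta> \<in> lipschitz_between d (- up) (- lo).
           (\<forall>\<epsilon> \<in> lipschitz_between d (- up) (- lo). \<epsilon> \<bullet> (- w) \<le> \<delta> \<bullet> (- w)) \<and>
           (\<delta> $ j = (- lo) $ j \<and> (\<forall>k. k \<noteq> j \<longrightarrow> \<delta> $ k = max ((- up) $ k) ((- lo) $ j - d k j)) \<or>
            (\<exists>l. l \<noteq> j \<and> (- up) $ l < (- lo) $ j - d l j \<and>
               \<delta> $ l = (- up) $ l \<and> \<delta> $ j = (- up) $ l + d l j \<and>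
               (\<forall>k. k \<notin> {j, l} \<longrightarrow> \<delta> $ k = max ((- up) $ k) (\<delta> $ j - d k j))))"
    using lo up w
    by (intro lipschitz_between_optimum_one_positive[of d, OF d])
      (simp_all only: minus_mem_lipschitz_between_iff, simp_all)
  then obtain \<delta> where \<delta>: "\<delta> \<in> lipschitz_between d (- up) (- lo)"
    and opt: "\<And>\<epsilon>. \<epsilon> \<in> lipschitz_between d (- up) (- lo) \<Longrightarrow> \<epsilon> \<bullet> (- w) \<le> \<delta> \<bullet> (- w)"
    and form: "\<delta> $ j = - lo $ j \<and> (\<forall>k. k \<noteq> j \<longrightarrow> \<delta> $ k = max (- up $ k) (- lo $ j - d k j)) \<or>
            (\<exists>l. l \<noteq> j \<and> - up $ l < - lo $ j - d l j \<and>
               \<delta> $ l = - up $ l \<and> \<delta> $ j = - up $ l + d l j \<and>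
               (\<forall>k. k \<notin> {j, l} \<longrightarrow> \<delta> $ k = max (- up $ k) (\<delta> $ j - d k j)))"
    by auto
  have max_min: "max (- a) (- c - e) = - min a (c + e)" for a c e :: real
    by (simp add: max_def min_def)
  have max_min': "max (- a) (c - e) = - min a (- c + e)" for a c e :: real
    by (simp add: max_def min_def)
  have mem: "- \<delta> \<in> lipschitz_between d lo up"
    using \<delta> minus_mem_lipschitz_between_iff[of "- \<delta>" d up lo] by simp
  have opt': "\<epsilon> \<bullet> w \<le> - \<delta> \<bullet> w" if "\<epsilon> \<in> lipschitz_between d lo up" for \<epsilon>
    using opt[of "- \<epsilon>"] that by (simp add: minus_mem_lipschitz_between_iff)
  from form show ?thesis
  proof (elim disjE exE conjE)
    assume "\<delta> $ j = - lo $ j" "\<forall>k. k \<noteq> j \<longrightarrow> \<delta> $ k = max (- up $ k) (- lo $ j - d k j)"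
    then show ?thesis
      using mem opt' by (intro bexI[of _ "- \<delta>"] conjI ballI disjI1) (auto simp: max_min)
  next
    fix l
    assume "l \<noteq> j" "- up $ l < - lo $ j - d l j" "\<delta> $ l = - up $ l" "\<delta> $ j = - up $ l + d l j"
      "\<forall>k. k \<notin> {j, l} \<longrightarrow> \<delta> $ k = max (- up $ k) (\<delta> $ j - d k j)"
    then show ?thesis
      using mem opt'
      by (intro bexI[of _ "- \<delta>"] conjI ballI disjI2 exI[of _ l]) (auto simp: max_min')
  qed
qed

section \<open>The graph distance and the uncertainty set\<close>

lemma graph_dist_triangle:
  assumes wg: "weighted_graph G \<gamma>" and con: "Digraph_Component.connected (with_proj G)"
  shows "graph_dist G \<gamma> i m \<le> graph_dist G \<gamma> i k + graph_dist G \<gamma> k m"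
proof -
  interpret G: pair_graph G using wg by (simp add: weighted_graph_def)
  obtain p q where p: "G.apath i p k" "graph_dist G \<gamma> i k = (\<Sum>(u, v)\<leftarrow>p. \<gamma> u v)"
    and q: "G.apath k q m" "graph_dist G \<gamma> k m = (\<Sum>(u, v)\<leftarrow>q. \<gamma> u v)"
    using graph_dist_shortest_path(1)[OF wg con] by meson
  have "G.awalk i (p @ q) m"
    using p(1) q(1) by (auto simp: G.apath_def intro: G.awalk_appendI)
  from graph_dist_shortest_path(2)[OF wg con this] show ?thesis
    using p(2) q(2) by simp
qed

lemma graph_dist_le_weight:
  assumes wg: "weighted_graph G \<gamma>" and con: "Digraph_Component.connected (with_proj G)"
    and e: "(i, k) \<in> parcs G"
  shows "graph_dist G \<gamma> i k \<le> \<gamma> i k"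
proof -
  interpret G: pair_graph G using wg by (simp add: weighted_graph_def)
  have "G.awalk i [(i, k)] k"
    using e wg by (simp add: G.awalk_Cons_iff G.awalk_Nil_iff weighted_graph_def)
  from graph_dist_shortest_path(2)[OF wg con this] show ?thesis by simp
qed

text \<open>The edge constraints add up along a shortest path.\<close>

lemma diff_le_graph_dist:
  fixes f :: "'n \<Rightarrow> real"
  assumes wg: "weighted_graph G \<gamma>" and con: "Digraph_Component.connected (with_proj G)"
    and edge: "\<And>u v. (u, v) \<in> parcs G \<Longrightarrow> f u - f v \<le> \<gamma> u v"
  shows "f i - f k \<le> graph_dist G \<gamma> i k"
proof -
  interpret G: pair_graph G using wg by (simp add: weighted_graph_def)
  have walk: "f i - f k \<le> (\<Sum>(u, v)\<leftarrow>p. \<gamma> u v)" if "G.awalk i p k" for i p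
    using that
  proof (induction p arbitrary: i)
    case Nil
    then show ?case by (simp add: G.awalk_Nil_iff)
  next
    case (Cons e p)
    obtain v where e: "e = (i, v)" "(i, v) \<in> parcs G" "G.awalk v p k"
      using Cons.prems by (cases e) (auto simp: G.awalk_Cons_iff)
    show ?case
      using Cons.IH[OF e(3)] edge[OF e(2)] e(1) by simp
  qed
  obtain p where "G.apath i p k" "graph_dist G \<gamma> i k = (\<Sum>(u, v)\<leftarrow>p. \<gamma> u v)"
    using graph_dist_shortest_path(1)[OF wg con] by meson
  then show ?thesis
    using walk[of i p] by (simp add: G.apath_def)
qed

text \<open>
  Symmetry of the distance: \<open>d(k, \<cdot>)\<close> changes by at most \<open>\<gamma> u v\<close> along an edge, so by the previous
  lemma its value at \<open>i\<close> exceeds its value \<open>0\<close> at \<open>k\<close> by at most \<open>d(i, k)\<close>.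
\<close>

lemma graph_dist_sym:
  assumes wg: "weighted_graph G \<gamma>" and con: "Digraph_Component.connected (with_proj G)"
  shows "graph_dist G \<gamma> i k = graph_dist G \<gamma> k i"
proof -
  interpret G: pair_graph G using wg by (simp add: weighted_graph_def)
  have "graph_dist G \<gamma> k i \<le> graph_dist G \<gamma> i k" for i k
  proof -
    have edge: "graph_dist G \<gamma> k u - graph_dist G \<gamma> k v \<le> \<gamma> u v" if uv: "(u, v) \<in> parcs G" for u v
    proof -
      have "(v, u) \<in> parcs G"
        using uv by (rule G.arcs_symmetric)
      moreover have "\<gamma> v u = \<gamma> u v"
        using uv wg by (auto simp: weighted_graph_def)
      ultimately show ?thesis
        using graph_dist_triangle[OF wg con, of k u v] graph_dist_le_weight[OF wg con, of v u]
        by linarith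
    qed
    have "graph_dist G \<gamma> k i - graph_dist G \<gamma> k k \<le> graph_dist G \<gamma> i k"
      by (rule diff_le_graph_dist[where f = "graph_dist G \<gamma> k", OF wg con]) (rule edge)
    then show ?thesis
      using graph_dist_shortest_path(3)[OF wg con, where j = k] by linarith
  qed
  then show ?thesis
    by (blast intro: antisym)
qed

text \<open>
  A feasible vector is 1-Lipschitz for the distance, hence the bound at each node \<open>k\<close> propagates to
  every node \<open>j\<close> with loss \<open>d(k, j)\<close>; the best of the propagated bounds are \<open>lo\<close> and \<open>up\<close>.
  Conversely \<open>k = j\<close> is among the competitors, so \<open>lo\<close> and \<open>up\<close> imply the original node bounds.
  As extrema of Lipschitz functions they are Lipschitz, and nonemptiness gives \<open>lo \<le> up\<close>.
\<close>

lemma uncertainty_set_eq_lipschitz_between: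
  fixes G :: "'n::finite pair_pre_digraph" and \<delta>h lo up :: "real ^ 'n"
  assumes wg: "weighted_graph G \<gamma>" and con: "Digraph_Component.connected (with_proj G)"
    and ne: "uncertainty_set G \<gamma> \<delta>h \<noteq> {}"
    and lo: "\<And>j. lo $ j = (MAX k. \<delta>h $ k - \<gamma> k k - graph_dist G \<gamma> k j)"
    and up: "\<And>j. up $ j = (MIN k. \<delta>h $ k + \<gamma> k k + graph_dist G \<gamma> k j)"
  shows "uncertainty_set G \<gamma> \<delta>h = lipschitz_between (graph_dist G \<gamma>) lo up"
    and "lo \<in> lipschitz_between (graph_dist G \<gamma>) lo up"
    and "up \<in> lipschitz_between (graph_dist G \<gamma>) lo up"
proof -
  let ?d = "graph_dist G \<gamma>"
  let ?U = "uncertainty_set G \<gamma> \<delta>h"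
  note tri = graph_dist_triangle[OF wg con] and sym = graph_dist_sym[OF wg con]
    and d0 = graph_dist_shortest_path(3)[OF wg con]
  have lo_ge: "\<delta>h $ k - \<gamma> k k - ?d k j \<le> lo $ j" for k j
    unfolding lo by (rule Max_ge) auto
  have up_le: "up $ j \<le> \<delta>h $ k + \<gamma> k k + ?d k j" for k j
    unfolding up by (rule Min_le) auto
  have lo_att: "\<exists>k. lo $ j = \<delta>h $ k - \<gamma> k k - ?d k j" for j
    using Max_in[of "range (\<lambda>k. \<delta>h $ k - \<gamma> k k - ?d k j)"] by (simp add: lo image_iff)
  have up_att: "\<exists>k. up $ j = \<delta>h $ k + \<gamma> k k + ?d k j" for j
    using Min_in[of "range (\<lambda>k. \<delta>h $ k + \<gamma> k k + ?d k j)"] by (simp add: up image_iff)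
  have lo_one: "lo $ i - lo $ j \<le> ?d i j" for i j
  proof -
    obtain k where "lo $ i = \<delta>h $ k - \<gamma> k k - ?d k i"
      using lo_att by blast
    then show ?thesis
      using lo_ge[of k j] tri[of k j i] by linarith
  qed
  have up_one: "up $ i - up $ j \<le> ?d i j" for i j
  proof -
    obtain k where "up $ j = \<delta>h $ k + \<gamma> k k + ?d k j"
      using up_att by blast
    then show ?thesis
      using up_le[of i k] tri[of k i j] sym[of j i] by linarith
  qed
  have lo_lip: "\<bar>lo $ i - lo $ j\<bar> \<le> ?d i j" and up_lip: "\<bar>up $ i - up $ j\<bar> \<le> ?d i j" for i j
    using lo_one[of i j] lo_one[of j i] up_one[of i j] up_one[of j i] sym[of i j] by linarith+
  have sub: "\<delta> \<in> lipschitz_between ?d lo up" if \<delta>: "\<delta> \<in> ?U" for \<delta>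
  proof -
    have node: "\<bar>\<delta> $ k - \<delta>h $ k\<bar> \<le> \<gamma> k k" for k
      using \<delta> by (simp add: uncertainty_set_def)
    have one: "\<delta> $ i - \<delta> $ j \<le> ?d i j" for i j
      by (rule diff_le_graph_dist[OF wg con]) (use \<delta> in \<open>force simp: uncertainty_set_def\<close>)
    have "\<bar>\<delta> $ i - \<delta> $ j\<bar> \<le> ?d i j" for i j
      using one[of i j] one[of j i] sym[of i j] by linarith
    moreover have "lo $ j \<le> \<delta> $ j" for j
    proof -
      obtain k where "lo $ j = \<delta>h $ k - \<gamma> k k - ?d k j"
        using lo_att by blast
      then show ?thesis
        using node[of k] one[of k j] by linarith
    qed
    moreover have "\<delta> $ j \<le> up $ j" for j
    proof -
      obtain k where "up $ j = \<delta>h $ k + \<gamma> k k + ?d k j"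
        using up_att by blast
      then show ?thesis
        using node[of k] one[of j k] sym[of j k] by linarith
    qed
    ultimately show ?thesis
      by (simp add: lipschitz_between_def)
  qed
  have "\<delta> \<in> ?U" if \<delta>: "\<delta> \<in> lipschitz_between ?d lo up" for \<delta>
  proof -
    have "\<bar>\<delta> $ k - \<delta>h $ k\<bar> \<le> \<gamma> k k" for k
    proof -
      have "lo $ k \<le> \<delta> $ k" "\<delta> $ k \<le> up $ k"
        using \<delta> by (auto simp: lipschitz_between_def)
      then show ?thesis
        using lo_ge[of k k] up_le[of k k] d0[of k] by linarith
    qed
    moreover have "\<bar>\<delta> $ i - \<delta> $ j\<bar> \<le> \<gamma> i j" if "(i, j) \<in> parcs G" for i j
    proof -
      have "\<bar>\<delta> $ i - \<delta> $ j\<bar> \<le> ?d i j"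
        using \<delta> by (simp add: lipschitz_between_def)
      then show ?thesis
        using graph_dist_le_weight[OF wg con that] by linarith
    qed
    ultimately show ?thesis
      by (auto simp: uncertainty_set_def)
  qed
  with sub show "?U = lipschitz_between ?d lo up"
    by blast
  obtain \<delta> where "\<delta> \<in> lipschitz_between ?d lo up"
    using ne sub by blast
  then have "lo $ k \<le> \<delta> $ k" "\<delta> $ k \<le> up $ k" for k
    by (auto simp: lipschitz_between_def)
  then have "lo $ k \<le> up $ k" for k
    by (rule order_trans)
  then show "lo \<in> lipschitz_between ?d lo up" "up \<in> lipschitz_between ?d lo up"
    using lo_lip up_lip by (auto simp: lipschitz_between_def)
qed

section \<open>Optimal solutions when one sign differs from all others\<close>

lemma optimal_solution_iff:
  "optimal_solution U C x \<delta> \<longleftrightarrow> \<delta> \<in> U \<and> (\<forall>\<epsilon>\<in>U. \<epsilon> \<bullet> (C *v x) \<le> \<delta> \<bullet> (C *v x))"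
  by (auto simp: optimal_solution_def is_arg_max_linorder)

theorem proposition13:
  fixes G :: "'n::finite pair_pre_digraph"
    and \<gamma> :: "'n \<Rightarrow> 'n \<Rightarrow> real"
    and \<delta>h lo up :: "real ^ 'n"
    and Z :: "((real ^ 'm) \<times> (real ^ 'p)) set"
    and C :: "real ^ 'm ^ 'n"
    and x :: "real ^ 'm"
    and y :: "real ^ 'p"
  assumes "weighted_graph G \<gamma>"
    and "Digraph_Component.connected (with_proj G)"
    and "uncertainty_set G \<gamma> \<delta>h \<noteq> {}"
    and "Z \<subseteq> {x. \<forall>i. 0 \<le> x $ i} \<times> {y. \<forall>i. 0 \<le> y $ i}"
    and "(x, y) \<in> Z"
    and "\<forall>j. lo $ j = (MAX k. \<delta>h $ k - \<gamma> k k - graph_dist G \<gamma> k j)"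
    and "\<forall>j. up $ j = (MIN k. \<delta>h $ k + \<gamma> k k + graph_dist G \<gamma> k j)"
  shows "(\<forall>j. S_plus_plus C Z = {j} \<and> S_minus C Z = UNIV - {j} \<longrightarrow>
           (\<exists>\<delta>. optimal_solution (uncertainty_set G \<gamma> \<delta>h) C x \<delta> \<and>
              (\<delta> $ j = up $ j \<and>
               (\<forall>k. k \<noteq> j \<longrightarrow> \<delta> $ k = max (lo $ k) (up $ j - graph_dist G \<gamma> k j)) \<or>
               (\<exists>l. l \<noteq> j \<and> lo $ l < up $ j - graph_dist G \<gamma> l j \<and>
                  \<delta> $ l = lo $ l \<and> \<delta> $ j = lo $ l + graph_dist G \<gamma> l j \<and>
                  (\<forall>k. k \<notin> {j, l} \<longrightarrow> \<delta> $ k = max (lo $ k) (\<delta> $ j - graph_dist G \<gamma> k j)))))) \<and>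
         (\<forall>j. S_minus_minus C Z = {j} \<and> S_plus C Z = UNIV - {j} \<longrightarrow>
           (\<exists>\<delta>. optimal_solution (uncertainty_set G \<gamma> \<delta>h) C x \<delta> \<and>
              (\<delta> $ j = lo $ j \<and>
               (\<forall>k. k \<noteq> j \<longrightarrow> \<delta> $ k = min (up $ k) (lo $ j + graph_dist G \<gamma> k j)) \<or>
               (\<exists>l. l \<noteq> j \<and> up $ l > lo $ j + graph_dist G \<gamma> l j \<and>
                  \<delta> $ l = up $ l \<and> \<delta> $ j = up $ l - graph_dist G \<gamma> l j \<and>
                  (\<forall>k. k \<notin> {j, l} \<longrightarrow> \<delta> $ k = min (up $ k) (\<delta> $ j + graph_dist G \<gamma> k j))))))"
proof (intro conjI allI impI; elim conjE)
  let ?d = "graph_dist G \<gamma>"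
  note wg = assms(1) and con = assms(2)
  note metric = graph_dist_shortest_path(3)[OF wg con] graph_dist_sym[OF wg con]
    graph_dist_triangle[OF wg con]
  note U = uncertainty_set_eq_lipschitz_between[OF wg con assms(3) assms(6)[rule_format]
      assms(7)[rule_format]]
  have comp: "(C *v x) $ k = C $ k \<bullet> x" for k
    by (rule matrix_vector_mul_component)
  have plus: "0 \<le> (C *v x) $ k" if "k \<in> S_plus C Z" for k
    using that assms(5) by (auto simp: S_plus_def comp)
  have minus: "(C *v x) $ k \<le> 0" if "k \<in> S_minus C Z" for k
    using that assms(5) by (auto simp: S_minus_def comp)
  {
    fix j
    assume "S_plus_plus C Z = {j}" "S_minus C Z = UNIV - {j}"
    then have "0 \<le> (C *v x) $ j" "\<forall>k. k \<noteq> j \<longrightarrow> (C *v x) $ k \<le> 0"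
      by (auto simp: S_plus_plus_def intro!: plus minus)
    from lipschitz_between_optimum_one_positive[of ?d, OF metric U(2,3) this]
    show "\<exists>\<delta>. optimal_solution (uncertainty_set G \<gamma> \<delta>h) C x \<delta> \<and>
              (\<delta> $ j = up $ j \<and>
               (\<forall>k. k \<noteq> j \<longrightarrow> \<delta> $ k = max (lo $ k) (up $ j - ?d k j)) \<or>
               (\<exists>l. l \<noteq> j \<and> lo $ l < up $ j - ?d l j \<and>
                  \<delta> $ l = lo $ l \<and> \<delta> $ j = lo $ l + ?d l j \<and>
                  (\<forall>k. k \<notin> {j, l} \<longrightarrow> \<delta> $ k = max (lo $ k) (\<delta> $ j - ?d k j))))"
      unfolding optimal_solution_iff U(1) Bex_def by (simp only: conj_assoc)
  next
    fix j
    assume "S_minus_minus C Z = {j}" "S_plus C Z = UNIV - {j}"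
    then have "(C *v x) $ j \<le> 0" "\<forall>k. k \<noteq> j \<longrightarrow> 0 \<le> (C *v x) $ k"
      by (auto simp: S_minus_minus_def intro!: plus minus)
    from lipschitz_between_optimum_one_negative[of ?d, OF metric U(2,3) this]
    show "\<exists>\<delta>. optimal_solution (uncertainty_set G \<gamma> \<delta>h) C x \<delta> \<and>
              (\<delta> $ j = lo $ j \<and>
               (\<forall>k. k \<noteq> j \<longrightarrow> \<delta> $ k = min (up $ k) (lo $ j + ?d k j)) \<or>
               (\<exists>l. l \<noteq> j \<and> up $ l > lo $ j + ?d l j \<and>
                  \<delta> $ l = up $ l \<and> \<delta> $ j = up $ l - ?d l j \<and>
                  (\<forall>k. k \<notin> {j, l} \<longrightarrow> \<delta> $ k = min (up $ k) (\<delta> $ j + ?d k j))))"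
      unfolding optimal_solution_iff U(1) Bex_def by (simp only: conj_assoc)
  }
qed

end
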